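(* Let $f\in QA$. If $I(f)$ contains $B(f)$, then $N(f)$ is infinitely connected, i.e. $N(f)$ has infinitely many connected components.
   Context: For $K>0$ and $\theta\in\mathbb{R}$, let $h_{K,\theta}:\mathbb{C}\to\mathbb{C}$ be the affine stretch $h_{K,\theta}(z)=\left(\frac{K+1}{2}\right)z+e^{2i\theta}\left(\frac{K-1}{2}\right)\overline{z}$. Let $$U=\{0<|z|<1,\ -\pi/4<\arg(z)\le \pi/4\}\cup\{|z|>1,\ -\pi/4<\arg(z)\le\pi/4\}\cup\{1\}\subset\mathbb{C},$$ and let $QA$ be the set of maps $f:\mathbb{C}\to\mathbb{C}$ of the form $f=g\circ h$ with $g(z)=z^2+c$, $c\in\mathbb{C}$, and $h=h_{K,\theta}$ with $Ke^{i\theta}\in U$. The escaping set is $I(f)=\{z\in\mathbb{C}: f^{n}(z)\to\infty\}$, where $f^n$ is the $n$-th iterate. $N(f)=\{z\in\mathbb{C}: \text{there is } T<\infty \text{ with } |f^n(z)|<T \text{ for all } n\in\mathbb{N}\}$ is the set of points with bounded orbit (it equals the complement of $I(f)$). The branch set $B(f)$ is the set of points at which $f$ is not locally injective. *)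

theory Defs
  imports "HOL-Analysis.Analysis"
begin

definition affine_stretch :: "real \<Rightarrow> real \<Rightarrow> complex \<Rightarrow> complex" where
  "affine_stretch K \<theta> z =
     of_real ((K + 1) / 2) * z + exp (2 * \<i> * of_real \<theta>) * of_real ((K - 1) / 2) * cnj z"

definition quadratic :: "complex \<Rightarrow> complex \<Rightarrow> complex" where
  "quadratic c z = z\<^sup>2 + c"

definition param_region :: "complex set" where
  "param_region =
     {z. 0 < cmod z \<and> cmod z < 1 \<and> - (pi / 4) < Arg z \<and> Arg z \<le> pi / 4}
     \<union> {z. cmod z > 1 \<and> - (pi / 4) < Arg z \<and> Arg z \<le> pi / 4}
     \<union> {1}"

definition QA :: "(complex \<Rightarrow> complex) set" where
  "QA = {quadratic c \<circ> affine_stretch K \<theta> | c K \<theta>.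
           K > 0 \<and> of_real K * exp (\<i> * of_real \<theta>) \<in> param_region}"

definition escaping_set :: "(complex \<Rightarrow> complex) \<Rightarrow> complex set" where
  "escaping_set f = {z. filterlim (\<lambda>n. (f ^^ n) z) at_infinity sequentially}"

definition bounded_orbit_set :: "(complex \<Rightarrow> complex) \<Rightarrow> complex set" where
  "bounded_orbit_set f = {z. \<exists>T::real. \<forall>n. cmod ((f ^^ n) z) < T}"

definition branch_set :: "(complex \<Rightarrow> complex) \<Rightarrow> complex set" where
  "branch_set f = {z. \<not> (\<exists>V. open V \<and> z \<in> V \<and> inj_on f V)}"

end

theory Submission
  imports Defs "HOL-Complex_Analysis.Conformal_Mappings"
begin

text \<open>Write \<open>f = g \<circ> h\<close> with \<open>g z = z\<^sup>2 + c\<close> and \<open>h\<close> an injective real-linear map of the plane.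
  Then \<open>f z = f w\<close> holds exactly for \<open>z = \<plusminus>w\<close>, so \<open>0\<close> is a branch point with critical value \<open>f 0 = c\<close>,
  and \<open>f\<close> has an escape radius \<open>R\<close>. The set \<open>N\<close> of points with bounded orbit is the nested intersection
  of the preimages of the disc of radius \<open>R\<close> under the iterates; it is compact, nonempty and
  completely invariant.

  Although \<open>f\<close> need not be holomorphic, it is an open map, and that alone gives a maximum principle for
  \<open>f\<close> and its iterates. On a bounded complementary component \<open>V\<close> of \<open>N\<close> all iterates would be bounded by
  \<open>R\<close>, as they are on the frontier of \<open>V\<close>; hence there is no such \<open>V\<close> and the complement of
  \<open>N\<close> is connected (\<open>connected_complement_bounded_orbit_set\<close>).

  If \<open>0\<close> escapes, then so does \<open>c\<close>, so \<open>w - c\<close> does not vanish on \<open>N\<close>. A compact plane set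
  with connected complement is Borsukian, which means that every zero-free continuous function on it has a
  continuous logarithm. Thus \<open>w - c\<close> has a continuous square root on \<open>N\<close>, and composing with the inverse of \<open>h\<close>
  gives a continuous branch \<open>s\<close> of the inverse of \<open>f\<close> on \<open>N\<close>. The compact sets \<open>s ` N\<close> and
  \<open>- s ` N\<close> cover \<open>N\<close> and are disjoint, each being a copy of \<open>N\<close>. If \<open>N\<close> had a
  finite number \<open>k \<ge> 1\<close> of components, it would follow that \<open>k = 2 k\<close>, which is absurd
  (\<open>infinite_components_of_two_inverse_branches\<close>).\<close>

section \<open>Components of a set with two disjoint inverse branches\<close>

lemma connected_subset_of_disjoint_compact_cover:
  fixes A B C :: "'a :: t2_space set"
  assumes "compact A" "compact B" "A \<inter> B = {}" "connected C" "C \<subseteq> A \<union> B" "C \<inter> A \<noteq> {}"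
  shows "C \<subseteq> A"
proof -
  have "closed A" "closed B"
    using assms(1,2) by (auto intro: compact_imp_closed)
  then have "A \<inter> C = {} \<or> B \<inter> C = {}"
    using assms by (intro connected_closedD) auto
  then show ?thesis
    using assms by blast
qed

text \<open>Since \<open>f\<close> carries components of \<open>N\<close> into components, it induces a self-map \<open>\<Phi>\<close> of the set of
  components. Every component \<open>E\<close> has at least two preimages under \<open>\<Phi>\<close>, one containing \<open>s ` E\<close> and one
  containing \<open>t ` E\<close>, because no component can meet both halves of \<open>N\<close>. A surjective
  self-map of a finite set is injective, so this is impossible for finitely many components.\<close>

lemma infinite_components_of_two_inverse_branches:
  fixes f s t :: "'a :: t2_space \<Rightarrow> 'a"
  assumes "compact N" "N \<noteq> {}"
    and f: "continuous_on N f" "f ` N \<subseteq> N"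
    and s: "continuous_on N s" "\<And>w. w \<in> N \<Longrightarrow> f (s w) = w"
    and t: "continuous_on N t" "\<And>w. w \<in> N \<Longrightarrow> f (t w) = w"
    and cover: "s ` N \<union> t ` N = N" and disjoint: "s ` N \<inter> t ` N = {}"
  shows "infinite (components N)"
proof
  assume fin: "finite (components N)"
  have "\<exists>D \<in> components N. f ` C \<subseteq> D" if "C \<in> components N" for C
  proof -
    have "connected (f ` C)"
      using that f(1) in_components_connected in_components_subset
      by (metis connected_continuous_image continuous_on_subset)
    moreover have "f ` C \<subseteq> N"
      using that f(2) in_components_subset by blast
    ultimately show ?thesis
      using exists_component_superset \<open>N \<noteq> {}\<close> by metis
  qed
  then obtain \<Phi> where \<Phi>: "\<And>C. C \<in> components N \<Longrightarrow> \<Phi> C \<in> components N \<and> f ` C \<subseteq> \<Phi> C"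
    by metis
  \<comment> \<open>An inverse branch \<open>r\<close> produces a \<open>\<Phi>\<close>-preimage of any component \<open>E\<close>.\<close>
  have lift: "\<exists>C \<in> components N. \<Phi> C = E \<and> r ` E \<subseteq> C"
    if E: "E \<in> components N" and r: "continuous_on N r" "r ` N \<subseteq> N" "\<And>w. w \<in> N \<Longrightarrow> f (r w) = w" for E r
  proof -
    have sub: "E \<subseteq> N" and ne: "E \<noteq> {}"
      using E in_components_subset in_components_nonempty by auto
    have "connected (r ` E)"
      using E r(1) sub in_components_connected by (metis connected_continuous_image continuous_on_subset)
    then obtain C where C: "C \<in> components N" "r ` E \<subseteq> C"
      using exists_component_superset \<open>N \<noteq> {}\<close> r(2) sub by (metis image_mono order_trans)
    obtain w where w: "w \<in> E"
      using ne by blast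
    have "f (r w) \<in> \<Phi> C"
      using \<Phi>[OF C(1)] C(2) w by blast
    then have "w \<in> \<Phi> C"
      using r(3) w sub by auto
    then have "\<Phi> C = E"
      using \<Phi>[OF C(1)] E w components_nonoverlap by blast
    then show ?thesis
      using C by blast
  qed
  have sN: "s ` N \<subseteq> N" and tN: "t ` N \<subseteq> N"
    using cover by auto
  have "components N \<subseteq> \<Phi> ` components N"
    using lift[OF _ s(1) sN s(2)] by blast
  then have inj: "inj_on \<Phi> (components N)"
    using fin by (rule finite_surj_inj[rotated])
  obtain E where E: "E \<in> components N"
    using \<open>N \<noteq> {}\<close> by (metis components_eq_empty ex_in_conv)
  obtain C where C: "C \<in> components N" "\<Phi> C = E" "s ` E \<subseteq> C"
    using lift[OF E s(1) sN s(2)] by blast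
  obtain D where D: "D \<in> components N" "\<Phi> D = E" "t ` E \<subseteq> D"
    using lift[OF E t(1) tN t(2)] by blast
  \<comment> \<open>By injectivity both lifts of \<open>E\<close> lie in one component, which then meets both halves of \<open>N\<close>.\<close>
  have "C = D"
    using inj C D by (auto dest: inj_onD)
  have sub: "E \<subseteq> N" and ne: "E \<noteq> {}"
    using E in_components_subset in_components_nonempty by auto
  have "C \<subseteq> s ` N"
  proof (rule connected_subset_of_disjoint_compact_cover)
    show "compact (s ` N)" "compact (t ` N)"
      using \<open>compact N\<close> s(1) t(1) by (auto intro: compact_continuous_image)
    show "connected C" "C \<subseteq> s ` N \<union> t ` N"
      using in_components_connected[OF C(1)] in_components_subset[OF C(1)] cover by auto
    show "C \<inter> s ` N \<noteq> {}"
      using C(3) sub ne by blast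
  qed (rule disjoint)
  moreover have "C \<inter> t ` N \<noteq> {}"
    using D(3) \<open>C = D\<close> sub ne by blast
  ultimately show False
    using disjoint by blast
qed

section \<open>The maximum principle for open maps\<close>

lemma open_map_euclidean_iff:
  "open_map euclidean euclidean f \<longleftrightarrow> (\<forall>U. open U \<longrightarrow> open (f ` U))"
  by (simp add: open_map_def)

lemma open_map_funpow: "open_map X X f \<Longrightarrow> open_map X X (f ^^ n)"
proof (induction n)
  case 0
  then show ?case
    by (simp add: open_map_def)
next
  case (Suc n)
  then show ?case
    using open_map_compose[of X X "f ^^ n" X f] by (simp add: comp_def)
qed

lemma continuous_on_funpow:
  fixes f :: "'a :: topological_space \<Rightarrow> 'a"
  shows "continuous_on UNIV f \<Longrightarrow> continuous_on UNIV (f ^^ n)"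
  by (induction n) (auto simp: id_def intro: continuous_on_compose2)

lemma open_set_has_larger_norm:
  fixes W :: "'a :: euclidean_space set"
  assumes "open W" "w \<in> W"
  obtains v where "v \<in> W" "norm w < norm v"
proof -
  obtain e where e: "0 < e" "cball w e \<subseteq> W"
    using assms open_contains_cball by blast
  obtain u :: 'a where u: "norm u = 1" "norm w < norm (w + e *\<^sub>R u)"
  proof (cases "w = 0")
    case True
    obtain u :: 'a where "norm u = 1"
      using vector_choose_size[of 1] by auto
    then show ?thesis
      using that True e by auto
  next
    case False
    have "w + e *\<^sub>R sgn w = (1 + e / norm w) *\<^sub>R w"
      by (simp add: sgn_div_norm algebra_simps divide_inverse)
    then have "norm (w + e *\<^sub>R sgn w) = norm w + e"
      using False e(1) by (simp add: field_simps)
    then show ?thesis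
      using that[of "sgn w"] False e(1) by (simp add: norm_sgn)
  qed
  then have "w + e *\<^sub>R u \<in> W"
    using e by (auto simp: dist_norm intro!: subsetD[OF e(2)])
  then show ?thesis
    using that u(2) by blast
qed

text \<open>The norm of \<open>F\<close> attains its maximum over the closure of \<open>V\<close>. It cannot do so in \<open>V\<close>, since the image
  of \<open>V\<close> is open and an open set has no point of largest norm; so it does so on the frontier.\<close>

lemma open_map_maximum_principle:
  fixes F :: "'a :: heine_borel \<Rightarrow> 'b :: euclidean_space"
  assumes "continuous_on UNIV F" "open_map euclidean euclidean F" "open V" "bounded V"
    and frontier: "\<And>x. x \<in> frontier V \<Longrightarrow> norm (F x) \<le> R"
    and "z \<in> V"
  shows "norm (F z) \<le> R"
proof -
  have "compact (closure V)" "closure V \<noteq> {}"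
    using assms by (auto simp: compact_closure)
  moreover have "continuous_on (closure V) (\<lambda>x. norm (F x))"
    using assms(1) by (auto intro: continuous_intros continuous_on_subset)
  ultimately obtain x where x: "x \<in> closure V" "\<And>y. y \<in> closure V \<Longrightarrow> norm (F y) \<le> norm (F x)"
    using continuous_attains_sup by metis
  have "x \<notin> V"
  proof
    assume "x \<in> V"
    then obtain v where "v \<in> F ` V" "norm (F x) < norm v"
      using assms(2,3) open_set_has_larger_norm[of "F ` V" "F x"]
      by (auto simp: open_map_euclidean_iff)
    then show False
      using x(2) closure_subset by (fastforce simp: not_le[symmetric])
  qed
  then have "x \<in> frontier V"
    using x(1) \<open>open V\<close> by (simp add: frontier_def interior_open)
  then show ?thesis
    using frontier x(2) closure_subset \<open>z \<in> V\<close> by (meson order_trans subsetD)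
qed

section \<open>The set of bounded orbits of a map with an escape radius\<close>

definition escape_radius :: "real \<Rightarrow> (complex \<Rightarrow> complex) \<Rightarrow> bool" where
  "escape_radius R f \<longleftrightarrow> 0 < R \<and> (\<forall>z. R < cmod z \<longrightarrow> 2 * cmod z \<le> cmod (f z))"

lemma bounded_orbit_set_image_iff: "f z \<in> bounded_orbit_set f \<longleftrightarrow> z \<in> bounded_orbit_set f"
proof
  assume "f z \<in> bounded_orbit_set f"
  then obtain T where T: "cmod ((f ^^ n) (f z)) < T" for n
    by (auto simp: bounded_orbit_set_def)
  have "cmod ((f ^^ n) z) < max T (cmod z + 1)" for n
  proof (cases n)
    case (Suc m)
    then show ?thesis
      using T[of m] by (simp add: funpow_Suc_right del: funpow.simps)
  qed auto
  then show "z \<in> bounded_orbit_set f"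
    by (auto simp: bounded_orbit_set_def)
next
  assume "z \<in> bounded_orbit_set f"
  then obtain T where T: "cmod ((f ^^ n) z) < T" for n
    by (auto simp: bounded_orbit_set_def)
  have "cmod ((f ^^ n) (f z)) < T" for n
    using T[of "Suc n"] by (simp add: funpow_Suc_right del: funpow.simps)
  then show "f z \<in> bounded_orbit_set f"
    by (auto simp: bounded_orbit_set_def)
qed

text \<open>Once an orbit leaves the disc of radius \<open>R\<close> it never returns, and its modulus at least doubles at
  each step.\<close>

lemma escape_radius_growth:
  assumes "escape_radius R f" "R < cmod z"
  shows "2 ^ n * cmod z \<le> cmod ((f ^^ n) z)"
proof (induction n)
  case (Suc n)
  have "1 * cmod z \<le> 2 ^ n * cmod z"
    by (intro mult_right_mono) auto
  then have "R < cmod ((f ^^ n) z)"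
    using Suc assms(2) by linarith
  then have "2 * cmod ((f ^^ n) z) \<le> cmod ((f ^^ Suc n) z)"
    using assms(1) by (simp add: escape_radius_def)
  then show ?case
    using Suc by simp
qed simp

text \<open>The orbits bounded by some \<open>T\<close> that depends on the starting point are thereby bounded by the
  single constant \<open>R\<close>, which is what makes the set closed.\<close>

lemma bounded_orbit_set_eq_INT:
  assumes "escape_radius R f"
  shows "bounded_orbit_set f = (\<Inter>n. (f ^^ n) -` cball 0 R)"
proof (intro equalityI subsetI)
  fix z assume "z \<in> bounded_orbit_set f"
  then obtain T where T: "cmod ((f ^^ n) z) < T" for n
    by (auto simp: bounded_orbit_set_def)
  have "cmod ((f ^^ n) z) \<le> R" for n
  proof (rule ccontr)
    assume "\<not> ?thesis"
    then have large: "R < cmod ((f ^^ n) z)"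
      by simp
    then have pos: "0 < cmod ((f ^^ n) z)"
      using assms unfolding escape_radius_def by linarith
    then obtain k where "T / cmod ((f ^^ n) z) < 2 ^ k"
      using real_arch_pow[of 2] by auto
    then have "T < 2 ^ k * cmod ((f ^^ n) z)"
      using pos by (simp add: field_simps)
    also have "\<dots> \<le> cmod ((f ^^ (k + n)) z)"
      using escape_radius_growth[OF assms large, of k] by (simp add: funpow_add)
    finally show False
      using T[of "k + n"] by simp
  qed
  then show "z \<in> (\<Inter>n. (f ^^ n) -` cball 0 R)"
    by simp
next
  fix z assume "z \<in> (\<Inter>n. (f ^^ n) -` cball 0 R)"
  then have "cmod ((f ^^ n) z) < R + 1" for n
    by (auto intro: le_less_trans[of _ R])
  then show "z \<in> bounded_orbit_set f"
    by (auto simp: bounded_orbit_set_def)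
qed

text \<open>The preimages of the closed disc under the iterates decrease, because an orbit outside the disc
  stays outside; they are nonempty because the iterates are surjective. Compactness then keeps the
  intersection from being empty.\<close>

lemma bounded_orbit_set_compact_nonempty:
  assumes R: "escape_radius R f" and cont: "continuous_on UNIV f" and "surj f"
  shows "compact (bounded_orbit_set f)" "bounded_orbit_set f \<noteq> {}"
proof -
  define F where "F n = (f ^^ n) -` cball 0 R" for n
  have Suc: "F (Suc n) \<subseteq> F n" for n
  proof
    fix z assume "z \<in> F (Suc n)"
    then have le: "cmod (f ((f ^^ n) z)) \<le> R"
      by (simp add: F_def)
    have "cmod ((f ^^ n) z) \<le> R"
    proof (rule ccontr)
      assume "\<not> ?thesis"
      then have "R < cmod ((f ^^ n) z)" "2 * cmod ((f ^^ n) z) \<le> cmod (f ((f ^^ n) z))"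
        using R by (auto simp: escape_radius_def)
      then show False
        using le by (smt (verit) norm_ge_zero)
    qed
    then show "z \<in> F n"
      by (simp add: F_def)
  qed
  have mono: "F n \<subseteq> F m" if "m \<le> n" for m n
    using Suc that by (rule lift_Suc_antimono_le)
  have "closed (F n)" for n
    unfolding F_def using continuous_on_funpow[OF cont]
    by (intro continuous_closed_vimage) (auto simp: continuous_on_eq_continuous_at)
  moreover have "F n \<subseteq> cball 0 R" for n
    using mono[of 0 n] by (simp add: F_def)
  ultimately have compact: "compact (F n)" for n
    by (metis bounded_cball bounded_subset compact_eq_bounded_closed)
  have "surj (f ^^ n)" for n
    using \<open>surj f\<close> by (simp add: surj_fn)
  then have ne: "F n \<noteq> {}" for n
    using R unfolding F_def escape_radius_def
    by (metis centre_in_cball less_imp_le rangeI surj_f_inv_f vimageI2 empty_iff)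
  have eq: "bounded_orbit_set f = (\<Inter>n. F n)"
    using bounded_orbit_set_eq_INT[OF R] by (simp add: F_def)
  then show "bounded_orbit_set f \<noteq> {}"
    using compact_nest[OF compact ne mono] by simp
  show "compact (bounded_orbit_set f)"
    unfolding eq using compact by (intro compact_Inter) auto
qed

text \<open>A bounded component \<open>V\<close> of the complement would have its frontier in the set of bounded orbits, where all
  iterates are bounded by \<open>R\<close>. The maximum principle extends this bound to \<open>V\<close>, so \<open>V\<close> would consist of bounded
  orbits. Hence all complementary components are unbounded, and the complement of a bounded plane set
  has only one such component.\<close>

lemma connected_complement_bounded_orbit_set:
  assumes R: "escape_radius R f" and cont: "continuous_on UNIV f" and "surj f" "open_map euclidean euclidean f"
  shows "connected (- bounded_orbit_set f)"
proof -
  let ?N = "bounded_orbit_set f"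
  have compact: "compact ?N"
    using bounded_orbit_set_compact_nonempty assms by blast
  have unbounded: "\<not> bounded V" if V: "V \<in> components (- ?N)" for V
  proof
    assume "bounded V"
    have "open V"
      using V compact by (meson compact_imp_closed open_Compl open_components)
    have "frontier V \<subseteq> ?N"
      using V compact by (simp add: compact_imp_closed frontier_of_components_closed_complement)
    then have frontier: "cmod ((f ^^ n) x) \<le> R" if "x \<in> frontier V" for n x
      using that unfolding bounded_orbit_set_eq_INT[OF R] by fastforce
    have "cmod ((f ^^ n) z) \<le> R" if "z \<in> V" for n z
      using continuous_on_funpow[OF cont] open_map_funpow[OF \<open>open_map euclidean euclidean f\<close>]
        \<open>open V\<close> \<open>bounded V\<close> frontier that
      by (rule open_map_maximum_principle)
    then have "V \<subseteq> ?N"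
      using bounded_orbit_set_eq_INT[OF R] by auto
    then show False
      using V in_components_subset in_components_nonempty by blast
  qed
  then show ?thesis
    using cobounded_unique_unbounded_components[of "- ?N"] compact
    unfolding connected_eq_connected_components_eq
    by (auto simp: compact_imp_bounded)
qed

section \<open>A quadratic map composed with a linear isomorphism\<close>

locale quadratic_stretch =
  fixes h :: "complex \<Rightarrow> complex" and c :: complex
  assumes linear: "linear h" and inj: "inj h"
begin

definition qmap :: "complex \<Rightarrow> complex" where
  "qmap = quadratic c \<circ> h"

lemma qmap_eq: "qmap z = (h z)\<^sup>2 + c"
  by (simp add: qmap_def quadratic_def)

lemma qmap_eq_iff: "qmap z = qmap w \<longleftrightarrow> z = w \<or> z = - w"
  using inj linear_neg[OF linear]
  by (auto simp: qmap_eq power2_eq_iff inj_eq) (metis inj_eq)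

lemma bij: "bij h"
  using linear inj linear_injective_imp_surjective by (auto simp: bij_def)

lemma continuous_qmap: "continuous_on UNIV qmap"
  unfolding qmap_eq[abs_def]
  by (intro continuous_intros linear_continuous_on linear_conv_bounded_linear[THEN iffD1] linear)

lemma surj_qmap: "surj qmap"
proof (rule surjI)
  show "qmap (inv h (csqrt (w - c))) = w" for w
    using bij by (simp add: qmap_eq bij_is_surj surj_f_inv_f)
qed

lemma open_map_qmap: "open_map euclidean euclidean qmap"
proof -
  have "open_map euclidean euclidean h"
    using open_surjective_linear_image linear bij by (auto simp: open_map_euclidean_iff bij_def)
  moreover have "open_map euclidean euclidean (quadratic c)"
    unfolding open_map_euclidean_iff
  proof (intro allI impI)
    fix U :: "complex set" assume "open U"
    have "quadratic c 0 \<noteq> quadratic c 1"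
      by (simp add: quadratic_def)
    then have "\<not> quadratic c constant_on UNIV"
      by (metis constant_on_def UNIV_I)
    moreover have "quadratic c holomorphic_on UNIV"
      unfolding quadratic_def[abs_def] by (intro holomorphic_intros)
    ultimately show "open (quadratic c ` U)"
      using open_mapping_thm[of "quadratic c" UNIV U] \<open>open U\<close> connected_UNIV by simp
  qed
  ultimately show ?thesis
    by (simp add: qmap_def open_map_compose)
qed

text \<open>An injective linear \<open>h\<close> satisfies \<open>\<bar>h z\<bar> \<ge> B \<bar>z\<bar>\<close> for some \<open>B > 0\<close>, so \<open>\<bar>h z\<bar>\<^sup>2\<close> grows quadratically and
  outweighs \<open>2 \<bar>z\<bar> + \<bar>c\<bar>\<close>.\<close>

lemma ex_escape_radius: "\<exists>R. escape_radius R qmap"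
proof -
  obtain B where B: "0 < B" "B * cmod z \<le> cmod (h z)" for z
    using linear_inj_bounded_below_pos[OF linear inj] by blast
  \<comment> \<open>Chosen so that \<open>B\<^sup>2 \<bar>z\<bar>\<^sup>2 \<ge> (2 + \<bar>c\<bar>) \<bar>z\<bar> \<ge> 2 \<bar>z\<bar> + \<bar>c\<bar>\<close> for \<open>\<bar>z\<bar> > R\<close>; the second
    inequality needs \<open>\<bar>z\<bar> \<ge> 1\<close>.\<close>
  define R where "R = max 1 ((2 + cmod c) / B\<^sup>2)"
  have "2 * cmod z \<le> cmod (qmap z)" if "R < cmod z" for z
  proof -
    have z: "1 < cmod z" "2 + cmod c \<le> B\<^sup>2 * cmod z"
      using that B(1) by (auto simp: R_def field_simps)
    have "2 * cmod z + cmod c \<le> (2 + cmod c) * cmod z"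
      using z(1) mult_left_mono[of 1 "cmod z" "cmod c"] by (simp add: algebra_simps)
    also have "\<dots> \<le> (B\<^sup>2 * cmod z) * cmod z"
      using z by (intro mult_right_mono) auto
    also have "\<dots> = (B * cmod z)\<^sup>2"
      by (simp add: power2_eq_square)
    also have "\<dots> \<le> (cmod (h z))\<^sup>2"
      using B by (intro power_mono) auto
    also have "\<dots> \<le> cmod (qmap z) + cmod c"
      using norm_triangle_ineq4[of "qmap z" c] by (simp add: qmap_eq norm_power)
    finally show ?thesis
      by simp
  qed
  then show ?thesis
    by (auto simp: escape_radius_def R_def intro!: exI[of _ R])
qed

text \<open>Every neighbourhood of \<open>0\<close> contains a pair of points \<open>\<plusminus>e\<close>, which the map identifies.\<close>

lemma zero_in_branch_set: "0 \<in> branch_set qmap"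
proof -
  have "\<not> inj_on qmap V" if V: "open V" "0 \<in> V" for V
  proof
    assume "inj_on qmap V"
    obtain e where e: "0 < e" "cball 0 e \<subseteq> V"
      using V open_contains_cball by blast
    then have "complex_of_real e \<in> V" "- complex_of_real e \<in> V"
      by (auto intro!: subsetD[OF e(2)])
    moreover have "qmap (complex_of_real e) = qmap (- complex_of_real e)"
      by (simp add: qmap_eq_iff)
    ultimately have "complex_of_real e = - complex_of_real e"
      using \<open>inj_on qmap V\<close> by (simp add: inj_on_eq_iff)
    then show False
      using e(1) by simp
  qed
  then show ?thesis
    by (auto simp: branch_set_def)
qed

text \<open>The connected complement of the set of bounded orbits supplies a continuous logarithm \<open>g\<close> of \<open>w - c\<close>
  there, and half of it gives the two inverse branches \<open>\<plusminus>s\<close>. Their images could only meet at a zero of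
  \<open>s\<close>, that is at the branch point, which has been excluded.\<close>

lemma infinite_components_bounded_orbit_set:
  assumes "0 \<notin> bounded_orbit_set qmap"
  shows "infinite (components (bounded_orbit_set qmap))"
proof -
  let ?N = "bounded_orbit_set qmap"
  obtain R where R: "escape_radius R qmap"
    using ex_escape_radius by blast
  have compact: "compact ?N" and ne: "?N \<noteq> {}"
    using bounded_orbit_set_compact_nonempty[OF R continuous_qmap surj_qmap] by auto
  have "Borsukian ?N"
    using connected_complement_bounded_orbit_set[OF R continuous_qmap surj_qmap open_map_qmap] compact
    by (simp add: Borsukian_separation_compact)
  moreover have "qmap 0 = c"
    by (simp add: qmap_eq linear_0[OF linear])
  then have "c \<notin> ?N"
    using assms bounded_orbit_set_image_iff[of qmap 0] by simp
  then have "(\<lambda>w. w - c) \<in> ?N \<rightarrow> - {0}"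
    by auto
  moreover have "continuous_on ?N (\<lambda>w. w - c)"
    by (intro continuous_intros)
  ultimately obtain g where g: "continuous_on ?N g" "\<And>w. w \<in> ?N \<Longrightarrow> w - c = exp (g w)"
    unfolding Borsukian_continuous_logarithm by blast
  obtain k where k: "linear k" "\<And>z. h (k z) = z"
    using linear_surjective_right_inverse[OF linear] bij by (metis bij_is_surj comp_apply id_apply)
  define s where "s w = k (exp (g w / 2))" for w
  have s_inv: "qmap (s w) = w" if "w \<in> ?N" for w
  proof -
    have "qmap (s w) = (exp (g w / 2))\<^sup>2 + c"
      by (simp add: qmap_eq s_def k)
    also have "\<dots> = w"
      using g(2)[OF that] by (simp flip: exp_double add: diff_eq_eq)
    finally show ?thesis .
  qed
  have t_inv: "qmap (- s w) = w" if "w \<in> ?N" for w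
    using s_inv[OF that] qmap_eq_iff[of "- s w" "s w"] by simp
  have s_cont: "continuous_on ?N s"
    unfolding s_def using g(1) k(1)
    by (intro continuous_on_compose2[OF linear_continuous_on[of k UNIV]] continuous_intros)
      (auto simp: linear_conv_bounded_linear)
  have "s ` ?N \<subseteq> ?N" "(\<lambda>w. - s w) ` ?N \<subseteq> ?N"
    using s_inv t_inv bounded_orbit_set_image_iff[of qmap] by (metis image_subsetI)+
  moreover have "z \<in> s ` ?N \<union> (\<lambda>w. - s w) ` ?N" if "z \<in> ?N" for z
  proof -
    have "qmap z \<in> ?N"
      using that bounded_orbit_set_image_iff by blast
    moreover from this have "z = s (qmap z) \<or> z = - s (qmap z)"
      using s_inv qmap_eq_iff by metis
    ultimately show ?thesis
      by blast
  qed
  ultimately have cover: "s ` ?N \<union> (\<lambda>w. - s w) ` ?N = ?N"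
    by blast
  have "s w \<noteq> - s v" if "w \<in> ?N" "v \<in> ?N" for w v
  proof
    assume eq: "s w = - s v"
    then have "w = v"
      using s_inv t_inv that by metis
    then have "s w = 0"
      using eq by simp
    then show False
      using assms cover that by (metis UnI1 image_eqI)
  qed
  then have "s ` ?N \<inter> (\<lambda>w. - s w) ` ?N = {}"
    by blast
  then show ?thesis
    using bounded_orbit_set_image_iff[of qmap] continuous_on_subset[OF continuous_qmap] cover
    by (intro infinite_components_of_two_inverse_branches[OF compact ne, of qmap s "\<lambda>w. - s w"]
          continuous_on_minus s_cont s_inv t_inv) auto
qed

end

section \<open>Affine stretches\<close>

lemma linear_affine_stretch: "linear (affine_stretch K \<theta>)"
  by (rule linearI) (simp_all add: affine_stretch_def algebra_simps scaleR_conv_of_real add_divide_distrib diff_divide_distrib)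

text \<open>On the kernel the two summands have equal modulus, but for \<open>K > 0\<close> the coefficient of \<open>z\<close>
  strictly dominates that of the conjugate: \<open>K + 1 > \<bar>K - 1\<bar>\<close>.\<close>

lemma inj_affine_stretch:
  assumes "K > 0"
  shows "inj (affine_stretch K \<theta>)"
  unfolding linear_injective_0[OF linear_affine_stretch]
proof (intro allI impI)
  fix z assume "affine_stretch K \<theta> z = 0"
  then have "of_real ((K + 1) / 2) * z = - (exp (2 * \<i> * of_real \<theta>) * of_real ((K - 1) / 2) * cnj z)"
    unfolding affine_stretch_def by (simp add: add_eq_0_iff2)
  then have "cmod (of_real ((K + 1) / 2) * z) = cmod (exp (2 * \<i> * of_real \<theta>) * of_real ((K - 1) / 2) * cnj z)"
    by (metis norm_minus_cancel)
  then have "\<bar>(K + 1) / 2\<bar> * cmod z = \<bar>(K - 1) / 2\<bar> * cmod z"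
    unfolding norm_mult norm_of_real complex_mod_cnj by simp
  then show "z = 0"
    using assms by auto
qed

theorem theorem5p4:
  fixes f :: "complex \<Rightarrow> complex"
  assumes "f \<in> QA"
    and "branch_set f \<subseteq> escaping_set f"
  shows "infinite (components (bounded_orbit_set f))"
proof -
  obtain c K \<theta> where f: "f = quadratic c \<circ> affine_stretch K \<theta>" and "K > 0"
    using assms(1) by (auto simp: QA_def)
  interpret quadratic_stretch "affine_stretch K \<theta>" c
    using \<open>K > 0\<close> by (intro quadratic_stretch.intro linear_affine_stretch inj_affine_stretch)
  have "f = qmap"
    by (simp add: f qmap_def)
  then have "0 \<in> escaping_set qmap"
    using assms(2) zero_in_branch_set by auto
  then have "0 \<notin> bounded_orbit_set qmap"
    unfolding escaping_set_def bounded_orbit_set_def filterlim_at_infinity_conv_norm_at_top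
    by (auto simp: filterlim_at_top eventually_sequentially not_less intro: le_refl)
  then show ?thesis
    using infinite_components_bounded_orbit_set \<open>f = qmap\<close> by simp
qed

end
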